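(* Let $\mu\in\mathbb{R}$ and $\sigma>0$, and let $X$ be normally distributed with mean $\mu$ and variance $\sigma^2$. Let $F$ and $f$ denote the cumulative distribution function and the probability density function of the standard normal distribution (mean $0$, variance $1$). For $r\in\mathbb{R}$ put $p=\frac{r-\mu}{\sigma}$. Then for every $r\in\mathbb{R}$, the first-order, complementary and second-order loss functions of $X$ are $$L_1(r)=(\mu-r)[1-F(p)]+\sigma f(p),$$ $$L_c(r)=(r-\mu)F(p)+\sigma f(p),$$ $$L_2(r)=\frac12[(r-\mu)^2+\sigma^2]\,[1-F(p)]-\frac{\sigma}{2}f(p)\,[r-\mu].$$
   Context: For a real random variable $X$ with probability density function $g$, the first-order loss function is $L_1(r)=\int_r^\infty(x-r)g(x)\,dx$, the complementary loss function is $L_c(r)=\int_{-\infty}^r(r-x)g(x)\,dx$, and the second-order loss function is $L_2(r)=\frac12\int_r^\infty(x-r)^2g(x)\,dx$. *)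

theory Defs
  imports "HOL-Probability.Probability"
begin

(* The argument g is the probability density function of the random variable. *)

definition first_order_loss :: "(real \<Rightarrow> real) \<Rightarrow> real \<Rightarrow> real" where
  "first_order_loss g r = (LBINT x:{r..}. (x - r) * g x)"

definition complementary_loss :: "(real \<Rightarrow> real) \<Rightarrow> real \<Rightarrow> real" where
  "complementary_loss g r = (LBINT x:{..r}. (r - x) * g x)"

definition second_order_loss :: "(real \<Rightarrow> real) \<Rightarrow> real \<Rightarrow> real" where
  "second_order_loss g r = 1 / 2 * (LBINT x:{r..}. (x - r)\<^sup>2 * g x)"

end

theory Submission
  imports Defs "HOL-Real_Asymp.Real_Asymp"
begin

text \<open>
  A density of \<open>X\<close> agrees almost everywhere with the normal density \<open>n\<close>. Expanding \<open>(x - r)\<^sup>k\<close> around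
  \<open>\<mu>\<close> reduces \<open>L\<^sub>1\<close> and \<open>L\<^sub>2\<close> to the tail integrals of \<open>(x - \<mu>)\<^sup>j n(x)\<close> for \<open>j \<le> 2\<close>. These follow from
  \<open>(\<sigma>\<^sup>2 n(x))' = -(x - \<mu>) n(x)\<close> and \<open>(\<sigma>\<^sup>2 (x - \<mu>) n(x))' = \<sigma>\<^sup>2 n(x) - (x - \<mu>)\<^sup>2 n(x)\<close>. Finally
  \<open>L\<^sub>c(r) - L\<^sub>1(r) = r - E X = r - \<mu>\<close>.
\<close>

text \<open>Integrability of \<open>f\<close> is a hypothesis instead of a sign condition, because
  the integrands it serves, such as \<open>(x - \<mu>) n(x)\<close>, may change sign on the
  half-line.\<close>

lemma set_integral_FTC_atLeast:
  fixes f F :: "real \<Rightarrow> real"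
  assumes F: "\<And>x. (F has_real_derivative f x) (at x)"
    and f: "\<And>x. isCont f x" "integrable lborel f"
    and lim: "(F \<longlongrightarrow> T) at_top"
  shows "(LBINT x:{r..}. f x) = T - F r"
proof -
  have "(LBINT x=ereal r..\<infinity>. f x) = T - F r"
  proof (rule interval_integral_FTC_integrable)
    show "set_integrable lborel (einterval (ereal r) \<infinity>) f"
      unfolding set_integrable_def by (intro integrable_mult_indicator f(2)) simp
    have "isCont F r"
      using F by (rule DERIV_isCont)
    then show "((F \<circ> real_of_ereal) \<longlongrightarrow> F r) (at_right (ereal r))"
      unfolding ereal_tendsto_simps by (auto simp: isCont_def intro: tendsto_mono[OF at_le])
    show "((F \<circ> real_of_ereal) \<longlongrightarrow> T) (at_left \<infinity>)"
      unfolding ereal_tendsto_simps by (rule lim)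
  qed (use F f in \<open>auto simp: has_real_derivative_iff_has_vector_derivative\<close>)
  \<comment> \<open>The interval integral runs over the open half-line; adding the null set
    \<open>{r}\<close> gives the closed one.\<close>
  also have "(LBINT x=ereal r..\<infinity>. f x) = (LBINT x:{r<..}. f x)"
    by (rule interval_integral_to_infinity_eq)
  also have "\<dots> = (LBINT x:{r..}. f x)"
    by (rule set_integral_discrete_difference[where X = "{r}"]) auto
  finally show ?thesis .
qed

lemma has_real_derivative_normal_density:
  assumes "\<sigma> > 0"
  shows "(normal_density \<mu> \<sigma> has_real_derivative - ((x - \<mu>) / \<sigma>\<^sup>2) * normal_density \<mu> \<sigma> x) (at x)"
proof -
  have "((\<lambda>x. c * exp (- (x - \<mu>)\<^sup>2 / (2 * \<sigma>\<^sup>2))) has_real_derivative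
      - ((x - \<mu>) / \<sigma>\<^sup>2) * (c * exp (- (x - \<mu>)\<^sup>2 / (2 * \<sigma>\<^sup>2)))) (at x)" for c
    using assms by (auto intro!: derivative_eq_intros simp: field_simps)
  then show ?thesis
    unfolding normal_density_def[abs_def] .
qed

lemma isCont_normal_density: "isCont (normal_density \<mu> \<sigma>) x"
  unfolding normal_density_def[abs_def] divide_inverse by (intro continuous_intros)

text \<open>The factor \<open>\<sigma>\<close> is the Jacobian of
  \<open>x = \<mu> + \<sigma> y\<close>. Besides the substitution, this turns boundary terms
  \<open>\<sigma>\<^sup>2 n(r)\<close> into \<open>\<sigma> f(p)\<close>.\<close>

lemma normal_density_standardize:
  assumes "\<sigma> > 0"
  shows "\<sigma> * normal_density \<mu> \<sigma> x = std_normal_density ((x - \<mu>) / \<sigma>)"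
  using assms by (simp add: normal_density_def real_sqrt_mult power_divide)

lemma set_integrable_normal_moment:
  assumes "\<sigma> > 0"
  shows "set_integrable lborel {r..} (\<lambda>x. normal_density \<mu> \<sigma> x * (x - \<mu>) ^ k)"
  unfolding set_integrable_def
  by (intro integrable_mult_indicator integrable_normal_moment assms) simp

text \<open>Substituting \<open>\<mu> + \<sigma> x\<close> for \<open>x\<close> turns the tail into
  the standard normal probability of \<open>{p..}\<close>, and passing to the complement brings in
  the \<open>cdf\<close>.\<close>

lemma normal_tail_0:
  assumes "\<sigma> > 0"
  shows "(LBINT x:{r..}. normal_density \<mu> \<sigma> x) = 1 - cdf std_normal_distribution ((r - \<mu>) / \<sigma>)"
proof -
  interpret real_distribution std_normal_distribution
    by (rule real_dist_normal_dist)
  define p where "p = (r - \<mu>) / \<sigma>"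
  have "(LBINT x:{r..}. normal_density \<mu> \<sigma> x)
      = \<sigma> * (\<integral>x. indicator {r..} (\<mu> + \<sigma> * x) * normal_density \<mu> \<sigma> (\<mu> + \<sigma> * x) \<partial>lborel)"
    using assms unfolding set_lebesgue_integral_def
    by (subst lborel_integral_real_affine[where c = \<sigma> and t = \<mu>]) auto
  also have "\<dots> = (\<integral>x. indicator {r..} (\<mu> + \<sigma> * x) * (\<sigma> * normal_density \<mu> \<sigma> (\<mu> + \<sigma> * x)) \<partial>lborel)"
    by (simp flip: integral_mult_right_zero add: mult_ac)
  also have "\<dots> = (\<integral>x. std_normal_density x * indicator {p..} x \<partial>lborel)"
    using assms unfolding normal_density_standardize[OF assms]
    by (intro Bochner_Integration.integral_cong) (auto simp: p_def indicator_def field_simps)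
  also have "\<dots> = measure std_normal_distribution {p..}"
    using integral_density[of "indicator {p..} :: real \<Rightarrow> real" lborel std_normal_density] by simp
  also have "\<dots> = measure std_normal_distribution {p<..}"
  proof (rule finite_measure_eq_AE)
    show "AE x in std_normal_distribution. x \<in> {p..} \<longleftrightarrow> x \<in> {p<..}"
      using AE_lborel_singleton[of p] by (auto simp: AE_density less_le)
  qed auto
  also have "\<dots> = 1 - measure std_normal_distribution {..p}"
    using prob_compl[of "{..p}"] by (simp add: Compl_eq_Diff_UNIV[symmetric])
  finally show ?thesis
    by (simp add: p_def cdf_def)
qed

lemma normal_tail_1:
  assumes "\<sigma> > 0"
  shows "(LBINT x:{r..}. normal_density \<mu> \<sigma> x * (x - \<mu>)) = \<sigma>\<^sup>2 * normal_density \<mu> \<sigma> r"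
proof -
  \<comment> \<open>The right-hand side has the shape \<open>T - F r\<close>, with limit
    \<open>T = 0\<close> at infinity.\<close>
  have "(LBINT x:{r..}. normal_density \<mu> \<sigma> x * (x - \<mu>)) = 0 - (- \<sigma>\<^sup>2 * normal_density \<mu> \<sigma> r)"
  proof (rule set_integral_FTC_atLeast)
    show "((\<lambda>x. - \<sigma>\<^sup>2 * normal_density \<mu> \<sigma> x) \<longlongrightarrow> 0) at_top"
      unfolding normal_density_def using assms by real_asymp
    show "integrable lborel (\<lambda>x. normal_density \<mu> \<sigma> x * (x - \<mu>))"
      using integrable_normal_moment[OF assms, of \<mu> 1] by simp
  qed (use assms in \<open>auto intro!: derivative_eq_intros has_real_derivative_normal_density
      continuous_intros isCont_normal_density\<close>)
  then show ?thesis by simp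
qed

text \<open>This is integration by parts: the second moment minus \<open>\<sigma>\<^sup>2\<close>
  times the density has an elementary antiderivative, while the tail of the density itself remains
  as an integral.\<close>

lemma normal_tail_2:
  assumes "\<sigma> > 0"
  shows "(LBINT x:{r..}. normal_density \<mu> \<sigma> x * (x - \<mu>)\<^sup>2)
    = \<sigma>\<^sup>2 * (r - \<mu>) * normal_density \<mu> \<sigma> r + \<sigma>\<^sup>2 * (LBINT x:{r..}. normal_density \<mu> \<sigma> x)"
proof -
  let ?n = "normal_density \<mu> \<sigma>"
  have "(LBINT x:{r..}. ?n x * (x - \<mu>)\<^sup>2 - \<sigma>\<^sup>2 * ?n x) = 0 - (- \<sigma>\<^sup>2 * ((r - \<mu>) * ?n r))"
  proof (rule set_integral_FTC_atLeast)
    show "((\<lambda>x. - \<sigma>\<^sup>2 * ((x - \<mu>) * ?n x)) \<longlongrightarrow> 0) at_top"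
      unfolding normal_density_def using assms by real_asymp
    show "integrable lborel (\<lambda>x. ?n x * (x - \<mu>)\<^sup>2 - \<sigma>\<^sup>2 * ?n x)"
      using integrable_normal_moment[OF assms, of \<mu> 2] assms by auto
    show "((\<lambda>x. - \<sigma>\<^sup>2 * ((x - \<mu>) * ?n x)) has_real_derivative ?n x * (x - \<mu>)\<^sup>2 - \<sigma>\<^sup>2 * ?n x) (at x)"
      for x using assms
      by (auto intro!: derivative_eq_intros has_real_derivative_normal_density
          simp: field_simps power2_eq_square)
  qed (auto intro!: continuous_intros isCont_normal_density)
  moreover have "(LBINT x:{r..}. ?n x * (x - \<mu>)\<^sup>2 - \<sigma>\<^sup>2 * ?n x)
      = (LBINT x:{r..}. ?n x * (x - \<mu>)\<^sup>2) - \<sigma>\<^sup>2 * (LBINT x:{r..}. ?n x)"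
    using set_integrable_normal_moment[OF assms, of r \<mu> 2]
      set_integrable_normal_moment[OF assms, of r \<mu> 0] by simp
  ultimately show ?thesis by simp
qed

lemma first_order_loss_normal:
  assumes "\<sigma> > 0"
  shows "first_order_loss (normal_density \<mu> \<sigma>) r
    = (\<mu> - r) * (1 - cdf std_normal_distribution ((r - \<mu>) / \<sigma>))
      + \<sigma> * std_normal_density ((r - \<mu>) / \<sigma>)"
proof -
  let ?n = "normal_density \<mu> \<sigma>"
  have "first_order_loss ?n r = (LBINT x:{r..}. ?n x * (x - \<mu>) + (\<mu> - r) * ?n x)"
    unfolding first_order_loss_def by (intro set_lebesgue_integral_cong) (auto simp: algebra_simps)
  also have "\<dots> = (LBINT x:{r..}. ?n x * (x - \<mu>)) + (\<mu> - r) * (LBINT x:{r..}. ?n x)"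
    using set_integrable_normal_moment[OF assms, of r \<mu> 1]
      set_integrable_normal_moment[OF assms, of r \<mu> 0] by simp
  finally show ?thesis
    using assms
    by (simp add: normal_tail_0 normal_tail_1 power2_eq_square
        flip: normal_density_standardize[OF assms])
qed

lemma second_order_loss_normal:
  assumes "\<sigma> > 0"
  shows "second_order_loss (normal_density \<mu> \<sigma>) r
    = 1 / 2 * ((r - \<mu>)\<^sup>2 + \<sigma>\<^sup>2) * (1 - cdf std_normal_distribution ((r - \<mu>) / \<sigma>))
      - \<sigma> / 2 * std_normal_density ((r - \<mu>) / \<sigma>) * (r - \<mu>)"
proof -
  let ?n = "normal_density \<mu> \<sigma>"
  have "(LBINT x:{r..}. (x - r)\<^sup>2 * ?n x)
      = (LBINT x:{r..}. (?n x * (x - \<mu>)\<^sup>2 + 2 * (\<mu> - r) * (?n x * (x - \<mu>))) + (\<mu> - r)\<^sup>2 * ?n x)"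
    by (intro set_lebesgue_integral_cong) (auto simp: algebra_simps power2_eq_square)
  also have "\<dots> = (LBINT x:{r..}. ?n x * (x - \<mu>)\<^sup>2) + 2 * (\<mu> - r) * (LBINT x:{r..}. ?n x * (x - \<mu>))
      + (\<mu> - r)\<^sup>2 * (LBINT x:{r..}. ?n x)"
    using set_integrable_normal_moment[OF assms, of r \<mu> 2]
      set_integrable_normal_moment[OF assms, of r \<mu> 1]
      set_integrable_normal_moment[OF assms, of r \<mu> 0]
    by (simp add: set_integral_add)
  \<comment> \<open>The boundary terms \<open>(r - \<mu>) \<sigma>\<^sup>2 n(r)\<close> and
    \<open>2 (\<mu> - r) \<sigma>\<^sup>2 n(r)\<close> add up to
    \<open>- (r - \<mu>) \<sigma> f(p)\<close>.\<close>
  finally show ?thesis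
    unfolding second_order_loss_def normal_tail_2[OF assms] normal_tail_1[OF assms]
      normal_tail_0[OF assms] normal_density_standardize[OF assms, symmetric]
    by (simp add: field_simps power2_eq_square)
qed

text \<open>The positive parts of \<open>r - x\<close> and \<open>x - r\<close> differ by
  \<open>r - x\<close>, whose mean is \<open>r - \<mu>\<close>. Hence no left tail has to be
  computed.\<close>

lemma complementary_loss_normal:
  assumes "\<sigma> > 0"
  shows "complementary_loss (normal_density \<mu> \<sigma>) r
    = (r - \<mu>) + first_order_loss (normal_density \<mu> \<sigma>) r"
proof -
  let ?n = "normal_density \<mu> \<sigma>"
  have expand: "(\<lambda>x. (r - x) * ?n x) = (\<lambda>x. r * ?n x - ?n x * x)"
    by (auto simp: algebra_simps)
  have int: "integrable lborel (\<lambda>x. (r - x) * ?n x)"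
    unfolding expand using integrable_normal_moment_nz_1[OF assms, of \<mu>] assms by simp
  have sint: "set_integrable lborel A (\<lambda>x. (r - x) * ?n x)" if "A \<in> sets borel" for A
    unfolding set_integrable_def using that by (intro integrable_mult_indicator int) simp
  have "r - \<mu> = (\<integral>x. (r - x) * ?n x \<partial>lborel)"
    unfolding expand using integrable_normal_moment_nz_1[OF assms, of \<mu>]
      integral_normal_moment_nz_1[OF assms, of \<mu>] assms by simp
  \<comment> \<open>The point \<open>r\<close> goes to the left piece only, so that the union is
    disjoint; it rejoins the right piece later as a null set.\<close>
  also have "\<dots> = (LBINT x:{..r} \<union> {r<..}. (r - x) * ?n x)"
    unfolding set_lebesgue_integral_def
    by (intro Bochner_Integration.integral_cong) (auto simp: indicator_def)
  also have "\<dots> = complementary_loss ?n r + (LBINT x:{r<..}. (r - x) * ?n x)"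
    unfolding complementary_loss_def by (intro set_integral_Un sint) auto
  also have "(LBINT x:{r<..}. (r - x) * ?n x) = (LBINT x:{r..}. (r - x) * ?n x)"
    by (rule set_integral_discrete_difference[where X = "{r}"]) auto
  also have "\<dots> = - first_order_loss ?n r"
    unfolding first_order_loss_def set_lebesgue_integral_def
    by (simp flip: integral_minus add: algebra_simps)
  finally show ?thesis by simp
qed

theorem mainTheorem5:
  fixes M :: "'a measure" and X :: "'a \<Rightarrow> real" and g :: "real \<Rightarrow> real"
    and \<mu> \<sigma> r p :: real and F f :: "real \<Rightarrow> real"
  assumes "prob_space M"
    and "\<sigma> > 0"
    and normal: "distributed M lborel X (normal_density \<mu> \<sigma>)"
    and pdf: "distributed M lborel X g" "\<And>x. g x \<ge> 0"
    and F: "F = cdf std_normal_distribution"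
    and f: "f = std_normal_density"
    and p: "p = (r - \<mu>) / \<sigma>"
  shows "first_order_loss g r = (\<mu> - r) * (1 - F p) + \<sigma> * f p
    \<and> complementary_loss g r = (r - \<mu>) * F p + \<sigma> * f p
    \<and> second_order_loss g r
        = 1 / 2 * ((r - \<mu>)\<^sup>2 + \<sigma>\<^sup>2) * (1 - F p) - \<sigma> / 2 * f p * (r - \<mu>)"
proof -
  let ?n = "normal_density \<mu> \<sigma>"
  interpret prob_space M by fact
  have [measurable]: "g \<in> borel_measurable borel"
    using distributed_real_measurable[of lborel g M X] pdf by simp
  \<comment> \<open>Uniqueness of densities compares the values under \<open>ennreal\<close>, which
    sends negative reals to 0; \<open>g x \<ge> 0\<close> carries the equality back to the
    reals.\<close>
  have ae: "AE x in lborel. g x = ?n x"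
    using distributed_unique[OF pdf(1) normal] pdf(2) by simp
  have cong: "(LBINT x:A. h x * g x) = (LBINT x:A. h x * ?n x)"
    if [measurable]: "A \<in> sets borel" "h \<in> borel_measurable borel" for A h
    using ae by (intro set_lebesgue_integral_cong_AE) auto
  have eqs: "first_order_loss g r = first_order_loss ?n r"
    "complementary_loss g r = complementary_loss ?n r"
    "second_order_loss g r = second_order_loss ?n r"
    unfolding first_order_loss_def complementary_loss_def second_order_loss_def
    by (simp_all add: cong)
  \<comment> \<open>For the complementary loss, \<open>(r - \<mu>) + (\<mu> - r) (1 - F p)\<close>
    collapses to \<open>(r - \<mu>) F p\<close>.\<close>
  show ?thesis
    unfolding eqs complementary_loss_normal[OF \<open>\<sigma> > 0\<close>] first_order_loss_normal[OF \<open>\<sigma> > 0\<close>]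
      second_order_loss_normal[OF \<open>\<sigma> > 0\<close>] F f p
    by (simp add: algebra_simps)
qed

end
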